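(* For any $\lambda\in\mathbb{C}$, the following are equivalent: (1) $R_\lambda$ is convex. (2) $R_\lambda$ is path-connected. (3) $R_\lambda$ contains a nonconstant path. (4) $R_\lambda$ has an accumulation point. (5) There exist $a,b\in R_\lambda$ such that $0<|a-b|<1$.
   Context: For $\lambda\in\mathbb{C}$, a set $S\subseteq\mathbb{C}$ is $\lambda$-convex if for all $a,b\in S$ the point $(1-\lambda)a+\lambda b$ is in $S$; it is $\lambda$-clonvex if it is $\lambda$-convex and topologically closed in $\mathbb{C}$. $R_\lambda$ denotes the smallest $\lambda$-clonvex set containing $\{0,1\}$. A path is a continuous function $\sigma:[0,1]\to\mathbb{C}$; a set contains a path if it contains its image. *)

theory Defs
  imports "HOL-Analysis.Analysis"
begin

definition lambda_convex :: "complex \<Rightarrow> complex set \<Rightarrow> bool" where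
  "lambda_convex l S \<longleftrightarrow> (\<forall>a\<in>S. \<forall>b\<in>S. (1 - l) * a + l * b \<in> S)"

definition lambda_clonvex :: "complex \<Rightarrow> complex set \<Rightarrow> bool" where
  "lambda_clonvex l S \<longleftrightarrow> lambda_convex l S \<and> closed S"

definition R :: "complex \<Rightarrow> complex set" where
  "R l = lambda_clonvex l hull {0, 1}"

lemma lambda_clonvex_Inter:
  "(\<And>S. S \<in> F \<Longrightarrow> lambda_clonvex l S) \<Longrightarrow> lambda_clonvex l (\<Inter>F)"
  unfolding lambda_clonvex_def lambda_convex_def by (auto intro: closed_Inter)

(* The hull, defined as an intersection, really is the smallest such set. *)
lemma R_smallest:
  "lambda_clonvex l (R l)" "{0, 1} \<subseteq> R l"
  "lambda_clonvex l S \<Longrightarrow> {0, 1} \<subseteq> S \<Longrightarrow> R l \<subseteq> S"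
  unfolding R_def
  by (blast intro: hull_in lambda_clonvex_Inter, rule hull_subset, rule hull_minimal)

end

theory Submission
  imports Defs
begin

text \<open>
  For \<open>a, b \<in> R l\<close> the affine map \<open>x \<mapsto> a + (b - a) x\<close> sends \<open>R l\<close> into itself, and if \<open>a \<noteq> b\<close> it also
  preserves the set \<open>P\<close> of limit points of \<open>R l\<close>. If \<open>0 < cmod (b - a) < 1\<close>, the fixed point of this
  contraction lies in \<open>P\<close>. Conversely, let \<open>P \<noteq> {}\<close> and \<open>l \<notin> [0, 1]\<close>, and suppose that \<open>P\<close> misses a
  point \<open>z\<close> (of the real line, if \<open>l\<close> is real). Let \<open>q\<close> be a point of \<open>P\<close> nearest to \<open>z\<close> and let
  \<open>q' \<in> R l\<close> be very close to \<open>q\<close>. Then \<open>q + (q' - q) t \<in> P\<close> for all \<open>t \<in> P\<close>, and \<open>P\<close> contains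
  \<open>t\<close> in all directions: the powers of a nonreal \<open>l\<close> meet every open half-plane, and for real \<open>l\<close> the
  numbers \<open>l\<close> and \<open>1 - l\<close> have opposite signs. So some point of \<open>P\<close> is closer to \<open>z\<close> than \<open>q\<close>.
\<close>

section \<open>Affine self-maps of \<open>R l\<close> and its limit points\<close>

lemma zero_one_in_R: "0 \<in> R l" "1 \<in> R l"
  using R_smallest(2)[of l] by auto

lemma closed_R: "closed (R l)"
  using R_smallest(1) by (simp add: lambda_clonvex_def)

lemma lambda_comb_in_R: "a \<in> R l \<Longrightarrow> b \<in> R l \<Longrightarrow> (1 - l) * a + l * b \<in> R l"
  using R_smallest(1)[of l] by (simp add: lambda_clonvex_def lambda_convex_def)

lemma generator_in_R: "l \<in> R l"
  using lambda_comb_in_R[OF zero_one_in_R] by simp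

text \<open>Affine maps commute with the combinations \<open>(1 - l) * x + l * y\<close>, so the
  preimage of \<open>R l\<close> is again \<open>l\<close>-clonvex. It contains 0 and 1, whose
  images are \<open>a\<close> and \<open>b\<close>, and minimality of \<open>R l\<close>
  applies.\<close>

lemma affine_in_R:
  assumes "a \<in> R l" "b \<in> R l" "x \<in> R l"
  shows "a + (b - a) * x \<in> R l"
proof -
  let ?S = "(\<lambda>x. a + (b - a) * x) -` R l"
  have "closed ?S"
    by (intro continuous_closed_vimage closed_R continuous_intros)
  moreover have "lambda_convex l ?S"
    unfolding lambda_convex_def
  proof (intro ballI)
    fix x y assume "x \<in> ?S" "y \<in> ?S"
    then have "(1 - l) * (a + (b - a) * x) + l * (a + (b - a) * y) \<in> R l"
      by (intro lambda_comb_in_R) auto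
    then show "(1 - l) * x + l * y \<in> ?S"
      by (simp add: algebra_simps)
  qed
  ultimately have "R l \<subseteq> ?S"
    using assms by (intro R_smallest(3)) (auto simp: lambda_clonvex_def)
  then show ?thesis using assms by auto
qed

lemma affine_limpt_R:
  assumes "a \<in> R l" "b \<in> R l" "a \<noteq> b" "t islimpt R l"
  shows "(a + (b - a) * t) islimpt R l"
proof -
  obtain f where f: "\<And>n. f n \<in> R l - {t}" "f \<longlonglongrightarrow> t"
    using assms(4) unfolding islimpt_sequential by auto
  have "(\<lambda>n. a + (b - a) * f n) \<longlonglongrightarrow> a + (b - a) * t"
    by (intro tendsto_intros f)
  moreover have "a + (b - a) * f n \<in> R l - {a + (b - a) * t}" for n
    using affine_in_R[OF assms(1,2), of "f n"] f(1)[of n] assms(3) by auto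
  ultimately show ?thesis
    unfolding islimpt_sequential by (intro exI[of _ "\<lambda>n. a + (b - a) * f n"]) auto
qed

lemma limpt_in_R: "t islimpt R l \<Longrightarrow> t \<in> R l"
  using closed_R closed_limpt by blast

text \<open>If \<open>p = 0\<close>, the map \<open>x \<mapsto> 1 - x\<close> moves it to the limit
  point 1.\<close>

lemma nonzero_limpt_R:
  assumes "p islimpt R l"
  obtains t where "t islimpt R l" "t \<noteq> 0"
  using affine_limpt_R[OF zero_one_in_R(2) zero_one_in_R(1) _ assms] assms that
  by (cases "p = 0") auto

lemma mult_limpt_R:
  assumes "a \<in> R l" "a \<noteq> 0" "t islimpt R l"
  shows "(a * t) islimpt R l"
  using affine_limpt_R[OF zero_one_in_R(1) assms(1) _ assms(3)] assms(2) by simp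

lemma power_mult_limpt_R:
  assumes "l \<noteq> 0" "t islimpt R l"
  shows "(l ^ k * t) islimpt R l"
  by (induction k) (use assms mult_limpt_R[OF generator_in_R] in \<open>auto simp: mult.assoc\<close>)

section \<open>Nonreal \<open>l\<close>: powers turn in every direction\<close>

lemma power_in_open_half_plane_aux:
  fixes l w :: complex
  assumes "w \<noteq> 0" "Im l > 0"
  shows "\<exists>k. Re (w * l ^ k) > 0"
proof -
  define \<theta> where "\<theta> = Arg l"
  define \<phi> where "\<phi> = Arg2pi w"
  have \<theta>: "0 < \<theta>" "\<theta> < pi"
    using assms(2) Arg_lt_pi[of l] by (auto simp: \<theta>_def)
  have \<phi>: "0 \<le> \<phi>" "\<phi> < 2 * pi"
    using Arg2pi[of w] by (auto simp: \<phi>_def)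
  have l0: "l \<noteq> 0" using assms(2) by auto
  have l: "l = rcis (cmod l) \<theta>"
    using l0 by (simp add: \<theta>_def rcis_cmod_Arg)
  have w: "w = rcis (cmod w) \<phi>"
    using Arg2pi_eq[of w] by (simp add: \<phi>_def rcis_def cis_conv_exp)
  have Re: "Re (w * l ^ k) = cmod w * cmod l ^ k * cos (\<phi> + real k * \<theta>)" for k
    by (subst l, subst w) (simp add: DeMoivre2 rcis_mult)
  \<comment> \<open>Cosine is positive on the arc from \<open>3 / 2 * pi\<close> to
    \<open>5 / 2 * pi\<close>. Its length \<open>pi\<close> exceeds the step
    \<open>\<theta>\<close>, so the first angle past the left end cannot jump over the arc; for
    \<open>k = 0\<close> the bound \<open>\<phi> < 2 * pi\<close> suffices.\<close>
  define k where "k = (LEAST k. \<phi> + real k * \<theta> > 3 / 2 * pi)"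
  have "\<exists>k. \<phi> + real k * \<theta> > 3 / 2 * pi"
    using ex_less_of_nat_mult[OF \<theta>(1), of "3 / 2 * pi"] \<phi>(1)
    by (metis add_increasing less_le_trans order_refl)
  then have k: "\<phi> + real k * \<theta> > 3 / 2 * pi"
    unfolding k_def by (rule LeastI_ex)
  have "\<phi> + real k * \<theta> < 5 / 2 * pi"
  proof (cases k)
    case 0
    then show ?thesis using \<phi> by simp
  next
    case (Suc m)
    then have "\<not> \<phi> + real m * \<theta> > 3 / 2 * pi"
      using not_less_Least[of m "\<lambda>k. \<phi> + real k * \<theta> > 3 / 2 * pi"] unfolding k_def by simp
    then show ?thesis using Suc \<theta> by (simp add: algebra_simps)
  qed
  with k have "cos (\<phi> + real k * \<theta> - 2 * pi) > 0"
    by (intro cos_gt_zero_pi) auto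
  then have "cos (\<phi> + real k * \<theta>) > 0"
    by (simp add: cos_diff)
  then have "Re (w * l ^ k) > 0"
    unfolding Re using assms(1) l0 by simp
  then show ?thesis ..
qed

lemma power_in_open_half_plane:
  fixes l w :: complex
  assumes "w \<noteq> 0" "l \<notin> \<real>"
  obtains k where "Re (w * l ^ k) > 0"
proof (cases "Im l > 0")
  case True
  then show ?thesis using power_in_open_half_plane_aux[OF assms(1)] that by blast
next
  case False
  \<comment> \<open>Conjugation moves \<open>l\<close> to the upper half-plane and preserves real
    parts.\<close>
  then have "Im (cnj l) > 0" using assms(2) by (auto simp: complex_is_Real_iff)
  then obtain k where "Re (cnj w * cnj l ^ k) > 0"
    using power_in_open_half_plane_aux[of "cnj w" "cnj l"] assms(1) by auto
  also have "cnj w * cnj l ^ k = cnj (w * l ^ k)" by simp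
  finally show ?thesis using that[of k] by (simp only: cnj.sel)
qed

text \<open>A sufficiently short step at an acute angle to \<open>v\<close> reduces the distance.
  Since an exponent chosen separately for each \<open>e n\<close> could grow with \<open>n\<close>
  and spoil shortness, \<open>k\<close> is fixed first, for a limit direction \<open>u\<close> of
  the \<open>e n\<close>, and only then is \<open>n\<close> taken large.\<close>

lemma power_step_closer:
  fixes l v :: complex and e :: "nat \<Rightarrow> complex"
  assumes "l \<notin> \<real>" "v \<noteq> 0" "e \<longlonglongrightarrow> 0" "\<And>n. e n \<noteq> 0"
  shows "\<exists>n k. cmod (v - e n * l ^ k) < cmod v"
proof -
  have "\<And>n. sgn (e n) \<in> sphere 0 1"
    using assms(4) by (auto simp: norm_sgn)
  then obtain u r where u: "u \<in> sphere 0 1" "strict_mono r" "((\<lambda>n. sgn (e n)) \<circ> r) \<longlonglongrightarrow> u"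
    using compact_imp_seq_compact[OF compact_sphere[of "0::complex" 1]] seq_compactE
    by (metis (no_types, lifting))
  have "cnj v * u \<noteq> 0" using assms(2) u(1) by auto
  then obtain k where k: "Re (cnj v * u * l ^ k) > 0"
    using power_in_open_half_plane assms(1) by blast
  have er: "(\<lambda>n. e (r n)) \<longlonglongrightarrow> 0"
    using LIMSEQ_subseq_LIMSEQ[OF assms(3) u(2)] by (simp add: o_def)
  \<comment> \<open>This is the decrease of the squared distance, divided by
    \<open>cmod (e (r n))\<close>; its limit is positive by the choice of \<open>k\<close>.\<close>
  have "(\<lambda>n. 2 * Re (cnj v * sgn (e (r n)) * l ^ k) - cmod (e (r n)) * cmod (l ^ k) ^ 2)
      \<longlonglongrightarrow> 2 * Re (cnj v * u * l ^ k) - cmod 0 * cmod (l ^ k) ^ 2"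
    using u(3) by (intro tendsto_intros er) (simp_all add: o_def)
  then have "\<forall>\<^sub>F n in sequentially.
      2 * Re (cnj v * sgn (e (r n)) * l ^ k) - cmod (e (r n)) * cmod (l ^ k) ^ 2 > 0"
    by (rule order_tendstoD) (use k in simp)
  then obtain n where n: "2 * Re (cnj v * sgn (e (r n)) * l ^ k) - cmod (e (r n)) * cmod (l ^ k) ^ 2 > 0"
    by (auto simp: eventually_sequentially)
  define c where "c = e (r n)"
  define w where "w = l ^ k"
  have c: "c = of_real (cmod c) * sgn c" "cmod c > 0"
    using assms(4)[of "r n"] by (auto simp: c_def sgn_div_norm scaleR_conv_of_real)
  have "Re (cnj v * c * w) = cmod c * Re (cnj v * sgn c * w)"
    by (subst c(1)) (simp add: algebra_simps)
  then have "2 * Re (cnj v * c * w) - (cmod c * cmod w)\<^sup>2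
      = cmod c * (2 * Re (cnj v * sgn c * w) - cmod c * cmod w ^ 2)"
    by (simp add: power2_eq_square algebra_simps)
  also have "\<dots> > 0" using n c(2) by (simp add: c_def w_def)
  finally have pos: "2 * Re (cnj v * c * w) - (cmod c * cmod w)\<^sup>2 > 0" .
  have "(cmod (v - c * w))\<^sup>2 = (cmod v)\<^sup>2 - (2 * Re (cnj v * (c * w)) - (cmod (c * w))\<^sup>2)"
    unfolding cmod_power2 by (simp add: power2_eq_square algebra_simps)
  then have "(cmod (v - c * w))\<^sup>2 < (cmod v)\<^sup>2"
    using pos by (simp add: norm_mult mult.assoc)
  then have "cmod (v - c * w) < cmod v"
    using power2_less_imp_less norm_ge_zero by blast
  then show ?thesis unfolding c_def w_def by blast
qed

lemma limpt_R_nonreal: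
  assumes "l \<notin> \<real>" "p islimpt R l"
  shows "z islimpt R l"
proof (rule ccontr)
  assume z: "\<not> z islimpt R l"
  have l0: "l \<noteq> 0" using assms(1) by auto
  obtain q where q: "q islimpt R l" "\<And>y. y islimpt R l \<Longrightarrow> dist z q \<le> dist z y"
    using distance_attains_inf[OF closed_limpts, of "R l" z] assms(2) by auto
  obtain t where t: "t islimpt R l" "t \<noteq> 0"
    using nonzero_limpt_R[OF assms(2)] .
  obtain f where f: "\<And>n. f n \<in> R l - {q}" "f \<longlonglongrightarrow> q"
    using q(1) unfolding islimpt_sequential by auto
  \<comment> \<open>The factor \<open>t\<close> is included so that the steps
    \<open>(f n - q) * t * l ^ k\<close> from \<open>q\<close> end at images of the limit points
    \<open>l ^ k * t\<close>.\<close>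
  have "(\<lambda>n. (f n - q) * t) \<longlonglongrightarrow> (q - q) * t"
    by (intro tendsto_intros f)
  moreover have "(f n - q) * t \<noteq> 0" for n using f(1)[of n] t by auto
  moreover have "z - q \<noteq> 0" using z q by auto
  ultimately obtain n k where "cmod ((z - q) - (f n - q) * t * l ^ k) < cmod (z - q)"
    using power_step_closer[OF assms(1), of "z - q" "\<lambda>n. (f n - q) * t"] by auto
  then have "dist z (q + (f n - q) * (l ^ k * t)) < dist z q"
    by (simp add: dist_norm algebra_simps)
  moreover have "(q + (f n - q) * (l ^ k * t)) islimpt R l"
    using f(1)[of n]
    by (intro affine_limpt_R limpt_in_R[OF q(1)] power_mult_limpt_R[OF l0 t(1)]) auto
  ultimately show False using q(2) by fastforce
qed

section \<open>Real \<open>l\<close>\<close>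

lemma R_real:
  assumes "l \<in> \<real>"
  shows "R l \<subseteq> \<real>"
  by (rule R_smallest(3))
     (use assms in \<open>auto simp: lambda_clonvex_def lambda_convex_def closed_complex_Reals\<close>)

lemma limpt_R_real:
  fixes s :: real
  assumes "s < 0 \<or> 1 < s" "p islimpt R (of_real s)" "z \<in> \<real>"
  shows "z islimpt R (of_real s)"
proof (rule ccontr)
  let ?R = "R (of_real s)"
  assume z: "\<not> z islimpt ?R"
  have Real: "x \<in> \<real>" if "x \<in> ?R" for x
    using R_real[of "of_real s"] that by auto
  obtain q where q: "q islimpt ?R" "\<And>y. y islimpt ?R \<Longrightarrow> dist z q \<le> dist z y"
    using distance_attains_inf[OF closed_limpts, of ?R z] assms(2) by auto
  obtain t0 where t0: "t0 islimpt ?R" "t0 \<noteq> 0"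
    using nonzero_limpt_R[OF assms(2)] .
  have "1 - of_real s \<in> ?R"
    using lambda_comb_in_R[OF zero_one_in_R(2) zero_one_in_R(1), of "of_real s"] by simp
  moreover have "1 - of_real s \<noteq> (0::complex)"
    using assms(1) by (metis eq_iff_diff_eq_0 less_irrefl not_one_less_zero of_real_1 of_real_eq_iff)
  ultimately have t1: "((1 - of_real s) * t0) islimpt ?R"
    by (intro mult_limpt_R t0)
  have t2: "(of_real s * t0) islimpt ?R"
    using assms(1) by (intro mult_limpt_R generator_in_R t0) auto
  obtain z' q' t' where eq: "z = of_real z'" "q = of_real q'" "t0 = of_real t'"
    using assms(3) Real[OF limpt_in_R[OF q(1)]] Real[OF limpt_in_R[OF t0(1)]] by (auto elim!: Reals_cases)
  \<comment> \<open>\<open>M\<close> bounds both \<open>s * t'\<close> and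
    \<open>(1 - s) * t'\<close> in absolute value, so for \<open>x\<close> this close to
    \<open>q\<close> neither step overshoots \<open>z\<close>.\<close>
  define M where "M = (1 + \<bar>s\<bar>) * \<bar>t'\<bar>"
  have M: "M > 0" using t0(2) eq by (auto simp: M_def)
  have zq: "z' \<noteq> q'" using z q eq by auto
  obtain x where x: "x \<in> ?R" "x \<noteq> q" "dist x q < \<bar>z' - q'\<bar> / M"
  proof -
    have "\<bar>z' - q'\<bar> / M > 0" using zq M by simp
    then show ?thesis using q(1) that unfolding islimpt_approachable by blast
  qed
  obtain x' where x': "x = of_real x'"
    using Real[OF x(1)] by (auto elim!: Reals_cases)
  define d where "d = x' - q'"
  have d: "d \<noteq> 0" "\<bar>d\<bar> * M < \<bar>z' - q'\<bar>"
    using x x' eq M by (auto simp: d_def dist_of_real dist_real_def field_simps)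
  have bound: "\<bar>d * (s * t')\<bar> < \<bar>z' - q'\<bar>" "\<bar>d * ((1 - s) * t')\<bar> < \<bar>z' - q'\<bar>"
  proof -
    have "\<bar>d * (r * t')\<bar> < \<bar>z' - q'\<bar>" if "\<bar>r\<bar> \<le> 1 + \<bar>s\<bar>" for r
    proof -
      have "\<bar>d * (r * t')\<bar> \<le> \<bar>d\<bar> * M"
        unfolding M_def abs_mult by (intro mult_left_mono mult_right_mono that) auto
      then show ?thesis using d(2) by simp
    qed
    then show "\<bar>d * (s * t')\<bar> < \<bar>z' - q'\<bar>" "\<bar>d * ((1 - s) * t')\<bar> < \<bar>z' - q'\<bar>" by auto
  qed
  have closer: False if "of_real r islimpt ?R" "\<bar>d * r\<bar> < \<bar>z' - q'\<bar>" "(z' - q') * (d * r) > 0" for r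
  proof -
    have "(q + (x - q) * of_real r) islimpt ?R"
      using affine_limpt_R[OF limpt_in_R[OF q(1)] x(1) _ that(1)] x(2) by auto
    also have "q + (x - q) * of_real r = of_real (q' + d * r)"
      by (simp add: eq x' d_def)
    finally have "dist z q \<le> dist z (of_real (q' + d * r))" by (rule q(2))
    then have "\<bar>z' - q'\<bar> \<le> \<bar>z' - q' - d * r\<bar>"
      by (simp add: eq dist_of_real dist_real_def algebra_simps del: of_real_add of_real_mult)
    moreover have "z' - q' > 0 \<and> d * r > 0 \<or> z' - q' < 0 \<and> d * r < 0"
      using that(3) by (simp only: zero_less_mult_iff)
    ultimately show False using that(2) by linarith
  qed
  \<comment> \<open>Of the steps \<open>d * (s * t')\<close> and \<open>d * ((1 - s) * t')\<close>,
    one therefore points from \<open>q'\<close> towards \<open>z'\<close>.\<close>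
  have neg: "s * (1 - s) < 0" using assms(1) by (auto simp: mult_less_0_iff)
  define y where "y = (z' - q') * (d * t')"
  have "y \<noteq> 0" using zq d t0(2) eq by (auto simp: y_def)
  then have "y * s > 0 \<or> y * (1 - s) > 0"
    using neg by (auto simp: zero_less_mult_iff mult_less_0_iff)
  then show False
    using closer[of "s * t'"] closer[of "(1 - s) * t'"] bound t1 t2 by (auto simp: eq y_def mult_ac)
qed

text \<open>A missing \<open>u\<close> would lie in a gap between two points \<open>a < b\<close> of
  the closed set \<open>S\<close>, chosen nearest to \<open>u\<close> on either side. But the
  combination of \<open>a\<close> and \<open>b\<close> with weight \<open>s\<close> falls strictly
  inside this gap.\<close>

lemma unit_interval_in_R:
  fixes s u :: real
  assumes "0 < s" "s < 1" "0 \<le> u" "u \<le> 1"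
  shows "of_real u \<in> R (of_real s)"
proof (rule ccontr)
  define S where "S = (of_real :: real \<Rightarrow> complex) -` R (of_real s)"
  assume "of_real u \<notin> R (of_real s)"
  then have u: "u \<notin> S" by (simp add: S_def)
  have S: "closed S"
    unfolding S_def by (intro continuous_closed_vimage closed_R continuous_intros)
  have 01: "0 \<in> S" "1 \<in> S" by (auto simp: S_def zero_one_in_R)
  have "compact (S \<inter> {0..u})" "compact (S \<inter> {u..1})"
    using S by (auto intro: closed_Int_compact)
  moreover have "S \<inter> {0..u} \<noteq> {}" "S \<inter> {u..1} \<noteq> {}"
    using 01 assms by auto
  ultimately obtain a b where a: "a \<in> S \<inter> {0..u}" "\<And>y. y \<in> S \<inter> {0..u} \<Longrightarrow> y \<le> a"
    and b: "b \<in> S \<inter> {u..1}" "\<And>y. y \<in> S \<inter> {u..1} \<Longrightarrow> b \<le> y"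
    using compact_attains_sup[of "S \<inter> {0..u}"] compact_attains_inf[of "S \<inter> {u..1}"] by blast
  have "a \<noteq> u" "b \<noteq> u" using a(1) b(1) u by auto
  then have ab: "a < b" using a(1) b(1) by simp
  define m where "m = a + s * (b - a)"
  have "a < m" using ab assms by (simp add: m_def)
  moreover have "s * (b - a) < 1 * (b - a)"
    using ab assms(2) by (intro mult_strict_right_mono) auto
  then have "m < b"
    by (simp add: m_def)
  moreover have "m \<in> S"
    using lambda_comb_in_R[of "of_real a" "of_real s" "of_real b"] a b
    by (simp add: S_def m_def algebra_simps)
  ultimately show False using a(1) b(1) a(2)[of m] b(2)[of m] by (cases "m \<le> u") auto
qed

section \<open>From a limit point to convexity\<close>

lemma convex_R_if_limpt:
  assumes "p islimpt R l"
  shows "convex (R l)"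
proof -
  \<comment> \<open>The unit interval suffices: affine self-maps of \<open>R l\<close> carry it onto
    the segment between any two points of \<open>R l\<close>.\<close>
  have unit: "of_real u \<in> R l" if "0 \<le> u" "u \<le> 1" for u
  proof (cases "l \<in> \<real>")
    case False
    then show ?thesis using limpt_R_nonreal[OF _ assms] limpt_in_R by blast
  next
    case True
    then obtain s where s: "l = of_real s" by (auto elim!: Reals_cases)
    consider "s < 0 \<or> 1 < s" | "0 < s" "s < 1" | "s = 0 \<or> s = 1" by linarith
    then show ?thesis
    proof cases
      case 1
      then show ?thesis using limpt_R_real[of s p "of_real u"] assms limpt_in_R s by auto
    next
      case 2
      then show ?thesis using unit_interval_in_R that s by blast
    next
      case 3
      \<comment> \<open>Here a combination just selects one of its two arguments, so
        \<open>R l\<close> is finite and has no limit point.\<close>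
      then have "lambda_clonvex l {0, 1}"
        using s by (auto simp: lambda_clonvex_def lambda_convex_def)
      then have "R l \<subseteq> {0, 1}" by (rule R_smallest(3)) simp
      then have "finite (R l)" using finite_subset by blast
      then show ?thesis using assms islimpt_finite by blast
    qed
  qed
  show ?thesis
    unfolding convex_alt
  proof (intro ballI allI impI)
    fix x y and u :: real assume "x \<in> R l" "y \<in> R l" "0 \<le> u \<and> u \<le> 1"
    then have "x + (y - x) * of_real u \<in> R l" by (intro affine_in_R unit) auto
    then show "(1 - u) *\<^sub>R x + u *\<^sub>R y \<in> R l" by (simp add: scaleR_conv_of_real algebra_simps)
  qed
qed

section \<open>Short differences and paths\<close>

lemma limpt_R_if_short_difference:
  assumes "a \<in> R l" "b \<in> R l" "0 < cmod (a - b)" "cmod (a - b) < 1"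
  shows "(a / (1 - (b - a))) islimpt R l"
proof -
  define c where "c = b - a"
  define p where "p = a / (1 - c)"
  have c: "c \<noteq> 0" "cmod c < 1" using assms by (auto simp: c_def norm_minus_commute)
  have "c \<noteq> 1" using c by auto
  then have p: "a + c * p = p" by (simp add: p_def field_simps)
  \<comment> \<open>One of 0 and 1 differs from the fixed point \<open>p\<close>. Its orbit under
    the contraction is \<open>p + c ^ n * (x - p)\<close>, which tends to \<open>p\<close> but never
    reaches it because \<open>c \<noteq> 0\<close>.\<close>
  obtain x where x: "x \<in> R l" "x \<noteq> p" using zero_one_in_R by (metis zero_neq_one)
  have in_R: "p + c ^ n * (x - p) \<in> R l" for n
  proof (induction n)
    case (Suc n)
    have "a + c * (p + c ^ n * (x - p)) \<in> R l"
      using affine_in_R[OF assms(1,2) Suc] by (simp add: c_def)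
    also have "a + c * (p + c ^ n * (x - p)) = (a + c * p) + c ^ Suc n * (x - p)"
      by (simp add: algebra_simps)
    finally show ?case using p by simp
  qed (use x in simp)
  have "(\<lambda>n. p + c ^ n * (x - p)) \<longlonglongrightarrow> p + 0 * (x - p)"
    by (intro tendsto_intros LIMSEQ_power_zero c)
  then have "p islimpt R l"
    unfolding islimpt_sequential
    by (intro exI[of _ "\<lambda>n. p + c ^ n * (x - p)"]) (use in_R x c in auto)
  then show ?thesis by (simp add: p_def c_def)
qed

lemma short_difference_if_limpt:
  assumes "p islimpt R l"
  shows "\<exists>a\<in>R l. \<exists>b\<in>R l. 0 < cmod (a - b) \<and> cmod (a - b) < 1"
proof -
  obtain a where "a \<in> R l" "a \<noteq> p" "dist a p < 1"
    using assms zero_less_one unfolding islimpt_approachable by blast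
  then show ?thesis using limpt_in_R[OF assms] by (auto simp: dist_norm)
qed

text \<open>The image of the path is connected and not a singleton, so none of its points is
  isolated.\<close>

lemma limpt_if_nonconstant_path:
  fixes \<sigma> :: "real \<Rightarrow> complex"
  assumes "path \<sigma>" "path_image \<sigma> \<subseteq> S" "\<not> \<sigma> constant_on {0..1}"
  shows "\<sigma> 0 islimpt S"
proof -
  have "\<nexists>a. path_image \<sigma> = {a}"
  proof
    assume "\<exists>a. path_image \<sigma> = {a}"
    then have "\<sigma> constant_on {0..1}" by (auto simp: path_image_def constant_on_def)
    then show False using assms by simp
  qed
  moreover have "\<sigma> 0 \<in> path_image \<sigma>" by (simp add: path_image_def)
  ultimately show ?thesis
    using connected_imp_perfect[OF connected_path_image[OF assms(1)]] assms(2) islimpt_subset by blast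
qed

lemma nonconstant_path_if_path_connected:
  assumes "path_connected S" "x \<in> S" "y \<in> S" "x \<noteq> y"
  shows "\<exists>\<sigma> :: real \<Rightarrow> 'a::real_normed_vector. path \<sigma> \<and> path_image \<sigma> \<subseteq> S \<and> \<not> \<sigma> constant_on {0..1}"
proof -
  obtain g where g: "path g" "path_image g \<subseteq> S" "pathstart g = x" "pathfinish g = y"
    using assms unfolding path_connected_def by blast
  then have "\<not> g constant_on {0..1}"
    using assms(4) by (force simp: constant_on_def pathstart_def pathfinish_def)
  then show ?thesis using g by blast
qed

theorem corollary3p5:
  fixes l :: complex
  shows "(convex (R l) \<longleftrightarrow> path_connected (R l)) \<and>
    (path_connected (R l) \<longleftrightarrow>
      (\<exists>\<sigma> :: real \<Rightarrow> complex. path \<sigma> \<and> path_image \<sigma> \<subseteq> R l \<and> \<not> \<sigma> constant_on {0..1})) \<and>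
    ((\<exists>\<sigma> :: real \<Rightarrow> complex. path \<sigma> \<and> path_image \<sigma> \<subseteq> R l \<and> \<not> \<sigma> constant_on {0..1}) \<longleftrightarrow>
      (\<exists>z. z islimpt R l)) \<and>
    ((\<exists>z. z islimpt R l) \<longleftrightarrow>
      (\<exists>a\<in>R l. \<exists>b\<in>R l. 0 < cmod (a - b) \<and> cmod (a - b) < 1))"
    (is "(?convex \<longleftrightarrow> ?pc) \<and> (?pc \<longleftrightarrow> ?path) \<and> (?path \<longleftrightarrow> ?limpt) \<and> (?limpt \<longleftrightarrow> ?short)")
proof -
  \<comment> \<open>The first four conditions form a cycle of implications; the fifth is tied to the
    existence of a limit point in both directions.\<close>
  have "?convex \<Longrightarrow> ?pc"
    by (rule convex_imp_path_connected)
  moreover have "?pc \<Longrightarrow> ?path"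
    by (rule nonconstant_path_if_path_connected[OF _ zero_one_in_R zero_neq_one])
  moreover have "?path \<Longrightarrow> ?limpt"
    using limpt_if_nonconstant_path by blast
  moreover have "?limpt \<Longrightarrow> ?convex"
    using convex_R_if_limpt by blast
  moreover have "?limpt \<Longrightarrow> ?short"
    using short_difference_if_limpt by blast
  moreover have "?short \<Longrightarrow> ?limpt"
    using limpt_R_if_short_difference by blast
  ultimately show ?thesis by argo
qed

end
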